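(* Let the integers $P^\ast(n)$, $n\ge 0$, be defined by $\sum_{n\geq 0}P^\ast(n)q^n=f_1^4f_5^4$. Then for all integers $n\geq 0$ and $\alpha\geq 1$, \[ P^\ast\left( 2 \cdot 5^{\alpha}n + 2 \cdot 5^{\alpha} -1\right)\equiv 0\pmod{2^2 \cdot 5^{\alpha}}. \]
   Context: For a positive integer $k$, $f_k:=(q^k;q^k)_\infty=\prod_{i\geq 1}(1-q^{ki})$, regarded as a formal power series in $q$ with integer coefficients. *)

theory Defs
  imports "HOL-Analysis.Infinite_Products"
    "HOL-Computational_Algebra.Formal_Power_Series"
    "HOL-Number_Theory.Cong"
begin

text \<open>
  The infinite product is taken in the \<open>X\<close>-adic metric topology on formal power series.
  The product index starts at 0, hence the exponent \<open>k * Suc i\<close>.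
\<close>
definition euler_f :: "nat \<Rightarrow> int fps" where
  "euler_f k = (\<Prod>i. 1 - fps_X ^ (k * Suc i))"

definition P_star :: "nat \<Rightarrow> int" where
  "P_star n = fps_nth (euler_f 1 ^ 4 * euler_f 5 ^ 4) n"

text \<open>
  For \<open>k > 0\<close> the product in the definition of \<^const>\<open>euler_f\<close>
  does converge, so its value is the genuine limit.
\<close>
lemma euler_f_has_prod:
  assumes "k > 0"
  shows   "(\<lambda>i. 1 - fps_X ^ (k * Suc i)) has_prod euler_f k"
proof -
  define F :: "nat \<Rightarrow> int fps" where "F = (\<lambda>i. 1 - fps_X ^ (k * Suc i))"
  define Q where "Q = (\<lambda>n. \<Prod>i\<le>n. F i)"
  define p where "p = Abs_fps (\<lambda>m. fps_nth (Q m) m)"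
  have step: "fps_nth (Q (Suc n)) m = fps_nth (Q n) m" if "m \<le> n" for m n
  proof -
    have "1 * Suc (Suc n) \<le> k * Suc (Suc n)"
      by (rule mult_right_mono) (use assms in auto)
    hence "m < k * Suc (Suc n)" using that by (simp only: mult_1)
    moreover have "Q (Suc n) = Q n - Q n * fps_X ^ (k * Suc (Suc n))"
      by (simp add: Q_def F_def algebra_simps)
    ultimately show ?thesis
      by (simp only: fps_sub_nth fps_X_power_mult_right_nth if_True diff_zero)
  qed
  have stable: "fps_nth (Q n) m = fps_nth p m" if "m \<le> n" for m n
    using that by (induction n rule: dec_induct) (auto simp: p_def step)
  have "Q \<longlonglongrightarrow> p"
    unfolding tendsto_fps_iff
    by (auto simp: eventually_at_top_linorder intro!: exI stable)
  moreover have "fps_nth p 0 = 1"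
    using assms by (simp add: p_def Q_def F_def)
  hence "p \<noteq> 0" by auto
  ultimately have "F has_prod p"
    by (simp add: has_prod_def raw_has_prod_def Q_def)
  thus ?thesis
    using has_prod_unique by (fastforce simp: F_def euler_f_def)
qed

end

theory Submission
  imports Defs
begin

text \<open>
  Write \<open>f\<close> for \<open>f\<^sub>1\<close>. The claim splits into a statement modulo 4 and one modulo powers of 5.

  Modulo 4 nothing about the product matters: if \<open>h\<close> is any integer power series, an odd
  coefficient of \<open>h\<^sup>2\<close> is a sum of equal pairs, hence even, and the same pairing applied to
  \<open>(h\<^sup>2)\<^sup>2\<close> shows that 4 divides the odd coefficients of \<open>h\<^sup>4\<close>
  (\<open>four_dvd_fps_fourth_power_nth_odd\<close>). Here \<open>h = f\<^sub>1 f\<^sub>5\<close>.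

  Modulo powers of 5 the exact relation \<open>P\<^sup>*(5 n + 4) = - 5 P\<^sup>*(n)\<close> (\<open>P_star_5\<close>) holds. In terms
  of modular forms, the series \<open>q f\<^sub>1\<^sup>4 f\<^sub>5\<^sup>4\<close> is the newform of weight 4 and level 5, and
  \<open>-5\<close> is its eigenvalue under \<open>U\<^sub>5\<close>. An elementary reason is the factorisation
  \<open>f\<^sup>4 = f \<cdot> f\<^sup>3\<close>. By Euler's pentagonal number theorem the exponents of \<open>f\<close> are congruent to
  0, 1 or 2 modulo 5, and by Jacobi's identity those of \<open>f\<^sup>3\<close> are congruent to 0, 1 or 3.
  The only way to reach the residue 4 is 1 + 3. The corresponding parts of the two series are
  again theta series: they equal \<open>- q f\<^bsub>25\<^esub>\<close> and \<open>5 q\<^sup>3 f\<^bsub>25\<^esub>\<^sup>3\<close>. So the part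
  of \<open>f\<^sup>4\<close> with exponents congruent to 4 is \<open>- 5 q\<^sup>4 f\<^bsub>25\<^esub>\<^sup>4\<close>, and the factor
  \<open>f\<^sub>5\<^sup>4\<close> is a series in \<open>q\<^sup>5\<close>, which passes through the dissection and becomes
  \<open>f\<^sub>1\<^sup>4\<close>.

  Euler's and Jacobi's identities are limits of polynomial identities in an arbitrary commutative
  ring, each proved by induction on the number of factors: \<open>shanks_identity\<close> for Euler, and
  \<open>jtp_coeff_weighted_sum\<close> with \<open>jtp_coeff_closed_form\<close> for Jacobi.
\<close>

section \<open>Finite forms of the identities of Euler and Jacobi\<close>

definition qpoch :: "'a::comm_ring_1 \<Rightarrow> nat \<Rightarrow> 'a" where
  "qpoch q n = (\<Prod>i\<in>{0<..n}. 1 - q ^ i)"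

lemma qpoch_0 [simp]: "qpoch q 0 = 1"
  by (simp add: qpoch_def)

lemma qpoch_Suc [simp]: "qpoch q (Suc n) = qpoch q n * (1 - q ^ Suc n)"
proof -
  have "{0<..Suc n} = insert (Suc n) {0<..n}" by auto
  thus ?thesis by (simp add: qpoch_def mult.commute)
qed

definition triangular :: "nat \<Rightarrow> nat" where
  "triangular k = k * (k + 1) div 2"

lemma triangular_0 [simp]: "triangular 0 = 0"
  by (simp add: triangular_def)

lemma triangular_Suc [simp]: "triangular (Suc k) = triangular k + Suc k"
proof -
  have "Suc k * (Suc k + 1) = k * (k + 1) + Suc k * 2" by (simp add: algebra_simps)
  thus ?thesis unfolding triangular_def by simp
qed

lemma two_triangular: "2 * triangular k = k * (k + 1)"
  by (induction k) auto

lemma triangular_ge: "k \<le> triangular k"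
  by (induction k) auto

text \<open>
  The generalised pentagonal numbers \<open>0, 2, 1, 7, 5, \<dots>\<close> for \<open>k = 0, 1, -1, 2, -2, \<dots>\<close>.
\<close>
definition pentagonal :: "int \<Rightarrow> nat" where
  "pentagonal k = nat (k * (3 * k + 1) div 2)"

lemma pentagonal_of_nat: "pentagonal (int n) = n * n + triangular n"
proof -
  have "int n * (3 * int n + 1) = 2 * int (n * n + triangular n)"
    using arg_cong[OF two_triangular[of n], of int] by (simp add: algebra_simps)
  thus ?thesis
    unfolding pentagonal_def
    by (metis nat_int nonzero_mult_div_cancel_left zero_neq_numeral)
qed

lemma pentagonal_minus_Suc: "pentagonal (- int (Suc n)) = Suc n * Suc n + triangular n"
proof -
  have "- int (Suc n) * (3 * - int (Suc n) + 1) = 2 * int (Suc n * Suc n + triangular n)"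
    using arg_cong[OF two_triangular[of n], of int] by (simp add: algebra_simps)
  thus ?thesis
    unfolding pentagonal_def
    by (metis nat_int nonzero_mult_div_cancel_left zero_neq_numeral)
qed

lemma two_pentagonal: "2 * int (pentagonal k) = k * (3 * k + 1)"
proof (cases k rule: int_cases)
  case (nonneg n)
  thus ?thesis
    using arg_cong[OF two_triangular[of n], of int]
    by (simp add: pentagonal_of_nat algebra_simps)
next
  case (neg n)
  show ?thesis
    using arg_cong[OF two_triangular[of n], of int] unfolding neg pentagonal_minus_Suc
    by (simp add: algebra_simps)
qed

definition int_sign :: "int \<Rightarrow> 'a::comm_ring_1" where
  "int_sign k = (if even k then 1 else -1)"

lemma int_sign_of_nat: "int_sign (int n) = (-1) ^ n"
  by (simp add: int_sign_def)

lemma int_sign_minus [simp]: "int_sign (- k) = int_sign k"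
  by (simp add: int_sign_def)

text \<open>
  As \<open>n\<close> grows, all summands on the left but the one for \<open>s = 0\<close> have order above \<open>n\<close>, and that
  one is the truncated Euler product: so this is a finite form of the pentagonal number theorem.
  Passing from \<open>n\<close> to \<open>n + 1\<close>, the change of the summand for \<open>s\<close> is a difference
  \<open>b (s + 1) - b s\<close>, hence the sum changes only by a boundary term and by the new summand for
  \<open>s = n + 1\<close>. These are the two powers of \<open>q\<close> by which the right-hand side grows.
\<close>
lemma shanks_identity:
  fixes q :: "'a::comm_ring_1"
  shows "(\<Sum>s\<le>n. (-1) ^ s * (\<Prod>i\<in>{s<..n}. 1 - q ^ i) * q ^ (s * n + triangular s)) =
         (\<Sum>k\<in>{- int n..int n}. int_sign k * q ^ pentagonal k)"
proof (induction n)
  case 0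
  thus ?case by (simp add: int_sign_def pentagonal_def)
next
  case (Suc n)
  define t where
    "t n s = (-1) ^ s * (\<Prod>i\<in>{s<..n}. 1 - q ^ i) * q ^ (s * n + triangular s)" for n s
  define b where "b s = (-1) ^ s * (\<Prod>i\<in>{s..n}. 1 - q ^ i) * q ^ (s * n + triangular s)" for s
  have step: "t (Suc n) s - t n s = b (Suc s) - b s" if "s \<le> n" for s
  proof -
    define Q where "Q = (\<Prod>i\<in>{s<..n}. 1 - q ^ i)"
    define E where "E = q ^ (s * n + triangular s)"
    have "{s<..Suc n} = insert (Suc n) {s<..n}" "{s..n} = insert s {s<..n}"
      "{Suc s..n} = {s<..n}"
      using that by auto
    hence "t (Suc n) s = (-1) ^ s * (Q * (1 - q * q ^ n)) * (E * q ^ s)"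
      and "t n s = (-1) ^ s * Q * E"
      and "b s = (-1) ^ s * ((1 - q ^ s) * Q) * E"
      and "b (Suc s) = - ((-1) ^ s) * Q * (E * (q * (q ^ n * q ^ s)))"
      by (simp_all add: t_def b_def Q_def E_def power_add mult_ac)
    thus ?thesis by (simp add: algebra_simps)
  qed
  have "(\<Sum>s\<le>Suc n. t (Suc n) s) - (\<Sum>s\<le>n. t n s) =
          t (Suc n) (Suc n) + (\<Sum>s\<le>n. t (Suc n) s - t n s)"
    by (simp add: sum_subtractf)
  also have "(\<Sum>s\<le>n. t (Suc n) s - t n s) = (\<Sum>s<Suc n. b (Suc s) - b s)"
    by (rule sum.cong) (auto simp: step)
  also have "\<dots> = b (Suc n) - b 0"
    by (rule sum_lessThan_telescope)
  \<comment> \<open>The product in \<open>b 0\<close> contains the factor \<open>1 - q ^ 0\<close>.\<close>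
  also have "b 0 = 0"
    by (auto simp: b_def intro!: prod_zero bexI[of _ 0])
  also have "t (Suc n) (Suc n) = int_sign (int (Suc n)) * q ^ pentagonal (int (Suc n))"
    unfolding pentagonal_of_nat int_sign_of_nat by (simp add: t_def)
  also have "b (Suc n) = int_sign (- int (Suc n)) * q ^ pentagonal (- int (Suc n))"
    unfolding int_sign_minus int_sign_of_nat pentagonal_minus_Suc
    by (simp add: b_def algebra_simps)
  finally have "(\<Sum>s\<le>Suc n. t (Suc n) s) = (\<Sum>s\<le>n. t n s) +
      int_sign (int (Suc n)) * q ^ pentagonal (int (Suc n)) +
      int_sign (- int (Suc n)) * q ^ pentagonal (- int (Suc n))"
    by (simp add: algebra_simps)
  moreover have "{- int (Suc n)..int (Suc n)} =
      insert (int (Suc n)) (insert (- int (Suc n)) {- int n..int n})"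
    by auto
  moreover have "int (Suc n) \<noteq> - int (Suc n)" "int (Suc n) \<notin> {- int n..int n}"
    "- int (Suc n) \<notin> {- int n..int n}"
    by auto
  ultimately show ?case
    using Suc.IH unfolding t_def by (simp add: add_ac del: of_nat_Suc)
qed

text \<open>
  For \<open>k \<ge> 0\<close> this is the coefficient of \<open>z\<^sup>k\<close> in the finite Jacobi triple product
  \<open>F\<^sub>n(z) = (1 - z\<^sup>-\<^sup>1) (\<Prod>i=1..n. (1 - z q\<^sup>i) (1 - z\<^sup>-\<^sup>1 q\<^sup>i))\<close>.
  The recursion multiplies by the next pair of factors,
  \<open>1 + q^(2n + 2) - q^(n + 1) (z + z\<^sup>-\<^sup>1)\<close>. Since \<open>F\<^sub>n(z\<^sup>-\<^sup>1) = - z F\<^sub>n(z)\<close>, the coefficient of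
  \<open>z\<^sup>-\<^sup>1\<^sup>-\<^sup>k\<close> is the negative of that of \<open>z\<^sup>k\<close>. Hence the natural indices suffice, and
  the coefficient of \<open>z\<^sup>-\<^sup>1\<close> enters the second equation as \<open>- jtp_coeff q n 0\<close>.
\<close>
fun jtp_coeff :: "'a::comm_ring_1 \<Rightarrow> nat \<Rightarrow> nat \<Rightarrow> 'a" where
  "jtp_coeff q 0 k = (if k = 0 then 1 else 0)"
| "jtp_coeff q (Suc n) 0 = (1 + q ^ (2 * n + 2)) * jtp_coeff q n 0
     - q ^ Suc n * (- jtp_coeff q n 0 + jtp_coeff q n 1)"
| "jtp_coeff q (Suc n) (Suc k) = (1 + q ^ (2 * n + 2)) * jtp_coeff q n (Suc k)
     - q ^ Suc n * (jtp_coeff q n k + jtp_coeff q n (Suc (Suc k)))"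

lemma jtp_coeff_eq_0: "n < k \<Longrightarrow> jtp_coeff q n k = 0"
  by (induction q n k rule: jtp_coeff.induct) auto

text \<open>
  Both sides are the derivative of \<open>F\<^sub>n\<close> at \<open>z = 1\<close>. On the left the terms for \<open>k\<close> and \<open>- 1 - k\<close>
  are combined; on the right only the factor \<open>1 - z\<^sup>-\<^sup>1\<close>, which vanishes at 1, has to be
  differentiated. The proof avoids the variable \<open>z\<close>: a shift of the index up and a shift down
  change the weight \<open>2 k + 1\<close> by \<open>2\<close> and by \<open>- 2\<close>, which cancel, so one step of the recursion
  multiplies the weighted sum by \<open>1 + q^(2n + 2) - 2 q^(n + 1)\<close>.
\<close>
lemma jtp_coeff_weighted_sum:
  "(\<Sum>k\<le>n. of_nat (2 * k + 1) * jtp_coeff q n k) = qpoch q n ^ 2"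
proof (induction n)
  case (Suc n)
  define G where "G = jtp_coeff q n"
  define w :: "nat \<Rightarrow> 'a" where "w k = of_nat (2 * k + 1)" for k
  have G0: "G k = 0" if "n < k" for k
    using that by (simp add: G_def jtp_coeff_eq_0)
  have w: "w (Suc k) = w k + 2" for k by (simp add: w_def)
  have S: "(\<Sum>k\<le>Suc n. w k * G k) = (\<Sum>k\<le>n. w k * G k)"
    by (simp add: G0)
  have up: "(\<Sum>k\<le>n. w (Suc k) * G k) = (\<Sum>k\<le>n. w k * G k) + 2 * (\<Sum>k\<le>n. G k)"
    by (simp add: w algebra_simps sum.distrib sum_distrib_left)
  have "(\<Sum>k\<le>Suc n. w k * G (Suc k)) = (\<Sum>k\<le>n. w k * G (Suc k))"
    by (simp add: G0)
  also have "\<dots> = (\<Sum>k\<le>n. w (Suc k) * G (Suc k)) - 2 * (\<Sum>k\<le>n. G (Suc k))"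
    by (simp add: w algebra_simps sum.distrib sum_distrib_left)
  also have "(\<Sum>k\<le>n. w (Suc k) * G (Suc k)) = (\<Sum>k\<le>Suc n. w k * G k) - w 0 * G 0"
    by (simp add: sum.atMost_Suc_shift del: sum.atMost_Suc)
  also have "(\<Sum>k\<le>n. G (Suc k)) = (\<Sum>k\<le>Suc n. G k) - G 0"
    by (simp add: sum.atMost_Suc_shift del: sum.atMost_Suc)
  finally have down: "(\<Sum>k\<le>Suc n. w k * G (Suc k)) =
      (\<Sum>k\<le>n. w k * G k) - 2 * (\<Sum>k\<le>n. G k) + G 0"
    by (simp add: G0 S w_def algebra_simps)
  have "(\<Sum>k\<le>Suc n. w k * jtp_coeff q (Suc n) k) =
      w 0 * jtp_coeff q (Suc n) 0 + (\<Sum>k\<le>n. w (Suc k) * jtp_coeff q (Suc n) (Suc k))"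
    by (rule sum.atMost_Suc_shift)
  also have "\<dots> = (1 + q ^ (2 * n + 2)) * (w 0 * G 0 + (\<Sum>k\<le>n. w (Suc k) * G (Suc k)))
      - q ^ Suc n * (- G 0 + (\<Sum>k\<le>n. w (Suc k) * G k)
          + (w 0 * G 1 + (\<Sum>k\<le>n. w (Suc k) * G (Suc (Suc k)))))"
    by (simp add: G_def w_def algebra_simps sum.distrib sum_distrib_left sum_subtractf)
  also have "w 0 * G 0 + (\<Sum>k\<le>n. w (Suc k) * G (Suc k)) = (\<Sum>k\<le>Suc n. w k * G k)"
    by (rule sum.atMost_Suc_shift [symmetric])
  also have "w 0 * G 1 + (\<Sum>k\<le>n. w (Suc k) * G (Suc (Suc k))) =
      (\<Sum>k\<le>Suc n. w k * G (Suc k))"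
    unfolding One_nat_def by (rule sum.atMost_Suc_shift [symmetric])
  finally have "(\<Sum>k\<le>Suc n. w k * jtp_coeff q (Suc n) k) =
      (1 + q ^ (2 * n + 2) - 2 * q ^ Suc n) * (\<Sum>k\<le>n. w k * G k)"
    unfolding up down S by (simp add: algebra_simps)
  also have "1 + q ^ (2 * n + 2) - 2 * q ^ Suc n = (1 - q ^ Suc n) ^ 2"
  proof -
    have "2 * n + 2 = Suc n + Suc n" by simp
    hence "q ^ (2 * n + 2) = q ^ Suc n * q ^ Suc n" by (simp only: power_add)
    thus ?thesis by (simp only: power2_eq_square) (simp add: algebra_simps del: power_Suc)
  qed
  also have "(\<Sum>k\<le>n. w k * G k) = qpoch q n ^ 2"
    using Suc.IH by (simp add: G_def w_def)
  finally show ?case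
    by (simp add: w_def power_mult_distrib mult.commute)
qed simp

text \<open>
  Up to sign and a power of \<open>q\<close>, the coefficients of the finite triple product are Gaussian
  binomial coefficients. The denominators are multiplied out because the \<open>q\<close>-factorials need not
  be invertible. In the induction step each of the three terms of the recursion is expressed
  through the common factor \<open>s k * M\<close>; with \<open>x = q^(n - k)\<close> and \<open>y = q^(n + k + 1)\<close> a polynomial
  identity in \<open>q\<close>, \<open>x\<close> and \<open>y\<close> remains.
\<close>
lemma jtp_coeff_closed_form:
  fixes q :: "'a::comm_ring_1"
  assumes "k \<le> n"
  shows "jtp_coeff q n k * (qpoch q (n - k) * qpoch q (n + k + 1)) =
         (-1) ^ k * q ^ triangular k * qpoch q (2 * n + 1)"
  using assms
proof (induction n arbitrary: k)
  case (Suc n)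
  define G where "G = jtp_coeff q n"
  define D where "D = qpoch q"
  define M where "M = D (2 * n + 1)"
  define s where "s j = (-1) ^ j * q ^ triangular j" for j
  have IH: "G j * (D (n - j) * D (n + j + 1)) = s j * M" if "j \<le> n" for j
    using Suc.IH[OF that] by (simp add: G_def D_def M_def s_def)
  have DS: "D (Suc m) = D m * (1 - q ^ Suc m)" for m
    by (simp add: D_def)
  have sS: "s (Suc j) = - (q ^ Suc j * s j)" for j
    by (simp add: s_def power_add)
  have "jtp_coeff q (Suc n) k * (D (Suc n - k) * D (Suc n + k + 1)) =
        s k * D (2 * Suc n + 1)"
  proof (cases "k = Suc n")
    case True
    have "jtp_coeff q (Suc n) k = - (q ^ Suc n) * G n"
      using True by (simp add: G_def jtp_coeff_eq_0)
    moreover have "D (Suc n + k + 1) = D (2 * n + 1) * (1 - q ^ (2 * n + 2)) * (1 - q ^ (2 * n + 3))"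
      using DS[of "2 * n + 1"] DS[of "2 * n + 2"] True
      by (simp add: eval_nat_numeral)
    moreover have "D (2 * Suc n + 1) = D (Suc n + k + 1)"
      using True by (simp add: mult_2)
    moreover have "G n * D (2 * n + 1) = s n * M" "D 0 = 1"
      using IH[of n] by (simp_all add: D_def mult_2)
    moreover have "- (q ^ Suc n) * G n * (1 * (D (2 * n + 1) * a * b)) =
        - (q ^ Suc n) * (G n * D (2 * n + 1)) * a * b" for a b
      by (simp add: mult_ac)
    ultimately show ?thesis
      using True by (simp only: diff_self_eq_0) (simp add: sS M_def mult_ac del: power_Suc)
  next
    case False
    with Suc.prems obtain d where d: "n = k + d"
      by (metis le_SucE le_iff_add)
    define x where "x = q ^ d"
    define y where "y = q ^ (n + k + 1)"
    \<comment> \<open>The coefficient with index \<open>k - 1\<close>, which by antisymmetry is \<open>- G 0\<close> for \<open>k = 0\<close>.\<close>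
    define p where "p = (case k of 0 \<Rightarrow> - G 0 | Suc j \<Rightarrow> G j)"
    define N where "N = D (Suc d) * D (n + k + 2)"
    have rec: "jtp_coeff q (Suc n) k =
        (1 + q ^ (2 * n + 2)) * G k - q ^ Suc n * (p + G (Suc k))"
      by (cases k) (simp_all add: G_def p_def)
    have powers: "q ^ (2 * n + 2) = q * (x * y)" "q ^ (2 * n + 3) = q * (q * (x * y))"
    proof -
      have "2 * n + 2 = Suc (d + (n + k + 1))" "2 * n + 3 = Suc (Suc (d + (n + k + 1)))"
        by (simp_all add: d)
      thus "q ^ (2 * n + 2) = q * (x * y)" "q ^ (2 * n + 3) = q * (q * (x * y))"
        by (simp_all only: x_def y_def power_Suc power_add)
    qed
    have N: "N = D d * D (n + k + 1) * ((1 - q * x) * (1 - q * y))"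
      using DS[of d] DS[of "n + k + 1"] by (simp add: N_def x_def y_def mult_ac)
    have mid: "G k * N = s k * M * ((1 - q * x) * (1 - q * y))"
      using IH[of k] unfolding N by (simp add: d flip: mult.assoc)
    have low: "q ^ Suc n * p * N = - (q * x) * (s k * M) * ((1 - y) * (1 - q * y))"
    proof (cases k)
      case 0
      hence "p = - G k" "q * x = q ^ Suc n" "x * q = y"
        by (simp_all add: p_def x_def y_def d)
      hence "q ^ Suc n * p * N = - (q * x) * (G k * N)" by (simp add: mult_ac)
      moreover have "q * x = y" using \<open>x * q = y\<close> by (simp add: mult.commute)
      ultimately show ?thesis unfolding mid by (simp add: mult.assoc)
    next
      case (Suc j)
      have "D (n + k + 2) = D (n + k) * (1 - y) * (1 - q * y)"
        using DS[of "n + k"] DS[of "n + k + 1"] by (simp add: y_def)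
      moreover have idx: "Suc d = n - j" "n + k = n + j + 1" "j \<le> n"
        using d Suc by simp_all
      ultimately have N': "N = D (n - j) * D (n + j + 1) * ((1 - y) * (1 - q * y))"
        unfolding N_def by (simp only: mult.assoc)
      have "p = G j"
        by (simp add: p_def Suc)
      hence "p * N = G j * (D (n - j) * D (n + j + 1)) * ((1 - y) * (1 - q * y))"
        unfolding N' by (simp only: mult.assoc)
      also note IH[OF idx(3)]
      finally have "p * N = s j * M * ((1 - y) * (1 - q * y))" .
      moreover have "q ^ Suc n * s j = - (q * x) * s k"
      proof -
        have "Suc n = Suc d + Suc j" using d Suc by simp
        hence "q ^ Suc n = q * x * q ^ Suc j" by (simp only: power_add x_def power_Suc)
        thus ?thesis unfolding Suc sS by (simp add: mult.assoc)
      qed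
      moreover have "q ^ Suc n * p * N = q ^ Suc n * (p * N)" by (rule mult.assoc)
      moreover have "q ^ Suc n * (s j * M * c) = (q ^ Suc n * s j) * M * c" for c
        by (simp only: mult.assoc)
      ultimately show ?thesis by (simp only: mult.assoc)
    qed
    have high: "q ^ Suc n * G (Suc k) * N = - (q * y) * (s k * M) * ((1 - x) * (1 - q * x))"
    proof (cases d)
      \<comment> \<open>Here \<open>G (k + 1)\<close> lies outside the support, and the factor \<open>1 - x\<close> vanishes as well.\<close>
      case 0
      thus ?thesis by (simp add: G_def d jtp_coeff_eq_0 x_def)
    next
      case (Suc e)
      have "D (Suc d) = D e * ((1 - x) * (1 - q * x))"
        using DS[of e] DS[of "Suc e"] by (simp add: x_def Suc mult.assoc)
      moreover have idx: "e = n - Suc k" "n + k + 2 = n + Suc k + 1" "Suc k \<le> n"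
        using d Suc by simp_all
      ultimately have N': "N = D (n - Suc k) * ((1 - x) * (1 - q * x)) * D (n + Suc k + 1)"
        unfolding N_def by simp
      have "G (Suc k) * N =
          G (Suc k) * (D (n - Suc k) * D (n + Suc k + 1)) * ((1 - x) * (1 - q * x))"
        unfolding N' by (simp only: mult_ac)
      also note IH[OF idx(3)]
      finally have "G (Suc k) * N = s (Suc k) * M * ((1 - x) * (1 - q * x))" .
      moreover have "q ^ Suc n * s (Suc k) = - (q * y) * s k"
      proof -
        have "Suc n + Suc k = Suc (n + k + 1)" by simp
        hence "q ^ Suc n * q ^ Suc k = q * y" by (simp only: y_def flip: power_add power_Suc)
        thus ?thesis unfolding sS by (simp flip: mult.assoc del: power_Suc)
      qed
      moreover have "q ^ Suc n * G (Suc k) * N = q ^ Suc n * (G (Suc k) * N)"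
        by (rule mult.assoc)
      moreover have "q ^ Suc n * (s (Suc k) * M * c) = (q ^ Suc n * s (Suc k)) * M * c" for c
        by (simp only: mult.assoc)
      ultimately show ?thesis by (simp only: mult.assoc)
    qed
    have "jtp_coeff q (Suc n) k * N =
        (1 + q ^ (2 * n + 2)) * (G k * N) - (q ^ Suc n * p * N + q ^ Suc n * G (Suc k) * N)"
      unfolding rec by (simp add: algebra_simps)
    also have "\<dots> = s k * M * ((1 - q * (x * y)) * (1 - q * (q * (x * y))))"
      unfolding mid low high powers by (simp add: algebra_simps)
    also have "\<dots> = s k * D (2 * Suc n + 1)"
    proof -
      have "D (2 * n + 2) = M * (1 - q ^ (2 * n + 2))" "2 * Suc n + 1 = Suc (2 * n + 2)"
        using DS[of "2 * n + 1"] by (simp_all add: M_def)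
      moreover have "Suc (2 * n + 2) = 2 * n + 3" by simp
      ultimately show ?thesis
        using DS[of "2 * n + 2"] by (simp only: powers mult.assoc)
    qed
    finally have "jtp_coeff q (Suc n) k * N = s k * D (2 * Suc n + 1)" .
    moreover have "Suc d = Suc n - k" "n + k + 2 = Suc n + k + 1"
      by (simp_all add: d)
    ultimately show ?thesis unfolding N_def by simp
  qed
  thus ?case by (simp add: D_def s_def)
qed simp


section \<open>Congruences between formal power series\<close>

lemma fps_X_power_dvd_iff:
  fixes f :: "'a::comm_ring_1 fps"
  shows "fps_X ^ n dvd f \<longleftrightarrow> (\<forall>i<n. fps_nth f i = 0)"
proof
  assume "fps_X ^ n dvd f"
  thus "\<forall>i<n. fps_nth f i = 0"
    by (auto simp: dvd_def fps_X_power_mult_nth)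
next
  assume "\<forall>i<n. fps_nth f i = 0"
  hence "f = fps_X ^ n * fps_shift n f"
    by (intro fps_ext) (simp add: fps_X_power_mult_nth)
  thus "fps_X ^ n dvd f"
    by (metis dvd_triv_left)
qed

lemma dvd_mult_fps_unit_cancel:
  fixes f g h :: "'a::comm_ring_1 fps"
  assumes "fps_nth f 0 = 1" "h dvd f * g"
  shows "h dvd g"
proof -
  have "f * fps_right_inverse f 1 = 1"
    by (rule fps_right_inverse) (simp add: assms)
  hence "g = (f * g) * fps_right_inverse f 1"
    by (metis mult.commute mult.left_commute mult_1_right)
  thus ?thesis
    using assms(2) by (metis dvd_mult2)
qed

text \<open>
  The later factors differ from 1 only in degrees above \<open>N\<close>, so the coefficients up to \<open>N\<close> are
  constant along the sequence of partial products from index \<open>N\<close> on.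
\<close>
lemma euler_f_nth_eq_partial_product:
  assumes "k > 0" "m \<le> N"
  shows "fps_nth (euler_f k) m = fps_nth (\<Prod>i<N. 1 - fps_X ^ (k * Suc i)) m"
proof -
  define Q :: "nat \<Rightarrow> int fps" where "Q = (\<lambda>N. \<Prod>i<N. 1 - fps_X ^ (k * Suc i))"
  have step: "fps_nth (Q (Suc N)) m = fps_nth (Q N) m" if "m \<le> N" for N
  proof -
    have "Suc N \<le> k * Suc N"
      using assms(1) by (cases k) auto
    hence "m < k * Suc N"
      using that by linarith
    moreover have "Q (Suc N) = Q N - Q N * fps_X ^ (k * Suc N)"
      by (simp add: Q_def algebra_simps)
    ultimately show ?thesis
      by (simp only: fps_sub_nth fps_X_power_mult_right_nth if_True diff_zero)
  qed
  have stable: "fps_nth (Q M) m = fps_nth (Q N) m" if "N \<le> M" for M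
    using that by (induction M rule: dec_induct) (use assms(2) in \<open>auto simp: step\<close>)
  have "Q \<longlonglongrightarrow> euler_f k"
    unfolding Q_def by (rule has_prod_imp_tendsto' [OF euler_f_has_prod [OF assms(1)]])
  hence "eventually (\<lambda>M. fps_nth (Q M) m = fps_nth (euler_f k) m) sequentially"
    unfolding tendsto_fps_iff by blast
  with eventually_ge_at_top[of N]
  have "eventually (\<lambda>M. fps_nth (Q N) m = fps_nth (euler_f k) m) sequentially"
    by eventually_elim (use stable in metis)
  thus ?thesis
    by (simp add: Q_def)
qed

lemma qpoch_fps_X: "qpoch fps_X N = (\<Prod>i<N. 1 - fps_X ^ (1 * Suc i))"
  by (induction N) simp_all

lemma euler_f_cong_qpoch:
  assumes "m \<le> N"
  shows "fps_X ^ Suc m dvd qpoch fps_X N - euler_f 1"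
  unfolding fps_X_power_dvd_iff qpoch_fps_X
  using assms euler_f_nth_eq_partial_product[of 1 _ N] by simp

lemma euler_f_nth_0: "fps_nth (euler_f 1) 0 = 1"
  using euler_f_nth_eq_partial_product[of 1 0 0] by simp

section \<open>The series of Euler and Jacobi\<close>

lemma int_sign_fps_const: "(int_sign k :: 'a::comm_ring_1 fps) = fps_const (int_sign k)"
  by (simp add: int_sign_def flip: fps_const_neg)

lemma pentagonal_bounds: "k \<in> {- int (pentagonal k)..int (pentagonal k)}"
proof (cases k rule: int_cases)
  case (nonneg n)
  have "n \<le> pentagonal (int n)"
    using triangular_ge[of n] unfolding pentagonal_of_nat by (rule trans_le_add2)
  thus ?thesis by (simp add: nonneg)
next
  case (neg n)
  have "Suc n \<le> pentagonal (- int (Suc n))"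
    unfolding pentagonal_minus_Suc by simp
  thus ?thesis unfolding neg by (simp del: of_nat_Suc)
qed

text \<open>
  The coefficient of degree \<open>m\<close> is read off Shanks's identity for \<open>n = m\<close>: in this degree only
  the summand for \<open>s = 0\<close> contributes.
\<close>
theorem pentagonal_number_theorem:
  "fps_nth (euler_f 1) m = (\<Sum>k | pentagonal k = m. int_sign k)"
proof -
  define t :: "nat \<Rightarrow> int fps" where
    "t s = (-1) ^ s * (\<Prod>i\<in>{s<..m}. 1 - fps_X ^ i) * fps_X ^ (s * m + triangular s)" for s
  have "fps_nth (t s) m = 0" if "s > 0" for s
  proof -
    have "m < s * m + triangular s"
      using that triangular_ge[of s] by (cases s) auto
    thus ?thesis unfolding t_def fps_X_power_mult_right_nth by simp
  qed
  hence "fps_nth (\<Sum>s\<le>m. t s) m = (\<Sum>s\<in>{0}. fps_nth (t s) m)"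
    unfolding fps_sum_nth by (intro sum.mono_neutral_right) auto
  also have "\<dots> = fps_nth (qpoch fps_X m) m"
    by (simp add: t_def qpoch_def)
  also have "\<dots> = fps_nth (euler_f 1) m"
    unfolding qpoch_fps_X by (rule euler_f_nth_eq_partial_product [symmetric]) simp_all
  finally have "fps_nth (euler_f 1) m =
      fps_nth (\<Sum>k\<in>{- int m..int m}. int_sign k * fps_X ^ pentagonal k) m"
    unfolding t_def shanks_identity ..
  also have "\<dots> = (\<Sum>k\<in>{- int m..int m}. if pentagonal k = m then int_sign k else 0)"
    by (auto simp: fps_sum_nth int_sign_fps_const intro!: sum.cong)
  also have "\<dots> = (\<Sum>k | k \<in> {- int m..int m} \<and> pentagonal k = m. int_sign k)"
    by (rule sum.inter_filter [symmetric]) simp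
  also have "{k. k \<in> {- int m..int m} \<and> pentagonal k = m} = {k. pentagonal k = m}"
    using pentagonal_bounds by blast
  finally show ?thesis .
qed

text \<open>
  In the limit the coefficients \<open>G k\<close> of the triple product satisfy \<open>f \<cdot> G k = s k\<close>, where \<open>s k\<close>
  is the signed power with exponent \<open>triangular k\<close>: in the closed form all three \<open>q\<close>-factorials
  tend to \<open>f\<close>. Multiplying the weighted sum of the \<open>G k\<close>, which tends to \<open>f\<^sup>2\<close>, by \<open>f\<close> gives
  the identity. All of this is done modulo \<open>q^(m + 1)\<close>.
\<close>
theorem jacobi_cube_identity:
  "fps_nth (euler_f 1 ^ 3) m = (\<Sum>k | triangular k = m. (-1) ^ k * (2 * int k + 1))"
proof -
  define f where "f = euler_f 1"
  define X where "X = (fps_X ^ Suc m :: int fps)"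
  \<comment> \<open>For \<open>k \<le> m\<close> this makes \<open>n - k \<ge> m\<close>, so that \<open>D (n - k)\<close> agrees with \<open>f\<close> up to degree \<open>m\<close>.\<close>
  define n where "n = 2 * m"
  define D where "D = qpoch (fps_X :: int fps)"
  define G where "G = jtp_coeff (fps_X :: int fps) n"
  define s :: "nat \<Rightarrow> int fps" where "s k = (-1) ^ k * fps_X ^ triangular k" for k
  have D: "X dvd D N - f" if "m \<le> N" for N
    using euler_f_cong_qpoch[OF that] by (simp add: X_def D_def f_def)
  have D0: "fps_nth (D N) 0 = 1" for N
    unfolding D_def by (induction N) simp_all
  have approx: "X dvd f * G k - s k" if "k \<le> n" for k
  proof -
    have closed: "G k * (D (n - k) * D (n + k + 1)) = s k * D (2 * n + 1)"
      using jtp_coeff_closed_form[OF that] by (simp only: G_def D_def s_def)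
    show ?thesis
    proof (cases "k \<le> m")
      case True
      \<comment> \<open>The closed form with all three \<open>q\<close>-factorials replaced by \<open>f\<close>, which then cancels.\<close>
      have "f * (f * G k - s k) =
          s k * (D (2 * n + 1) - f) - G k * D (n + k + 1) * (D (n - k) - f)
            - G k * f * (D (n + k + 1) - f)"
        using closed by (simp add: algebra_simps)
      also have "X dvd \<dots>"
        using True by (intro dvd_diff dvd_mult D) (simp_all add: n_def)
      finally show ?thesis
        by (rule dvd_mult_fps_unit_cancel[rotated]) (unfold f_def, rule euler_f_nth_0)
    next
      \<comment> \<open>Now \<open>n - k\<close> may be small, but both \<open>G k\<close> and \<open>s k\<close> vanish up to degree \<open>m\<close>.\<close>
      case False
      hence "Suc m \<le> triangular k"
        using triangular_ge[of k] by simp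
      hence s: "X dvd s k"
        unfolding s_def X_def by (intro dvd_mult le_imp_power_dvd)
      hence "X dvd (D (n - k) * D (n + k + 1)) * G k"
        using closed by (simp add: mult.commute)
      hence "X dvd G k"
        by (rule dvd_mult_fps_unit_cancel[rotated]) (simp add: D0)
      thus ?thesis
        using s by simp
    qed
  qed
  have "X dvd (\<Sum>k\<le>n. of_nat (2 * k + 1) * (f * G k - s k))"
    by (intro dvd_sum dvd_mult approx) simp
  also have "(\<Sum>k\<le>n. of_nat (2 * k + 1) * (f * G k - s k)) =
      f * (\<Sum>k\<le>n. of_nat (2 * k + 1) * G k) - (\<Sum>k\<le>n. of_nat (2 * k + 1) * s k)"
    by (simp add: algebra_simps sum_subtractf sum.distrib sum_distrib_left)
  also have "(\<Sum>k\<le>n. of_nat (2 * k + 1) * G k) = D n ^ 2"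
    unfolding G_def D_def by (rule jtp_coeff_weighted_sum)
  finally have "X dvd f * D n ^ 2 - (\<Sum>k\<le>n. of_nat (2 * k + 1) * s k)" .
  moreover have "X dvd f * (D n + f) * (D n - f)"
    by (intro dvd_mult D) (simp add: n_def)
  ultimately have "X dvd (f * D n ^ 2 - (\<Sum>k\<le>n. of_nat (2 * k + 1) * s k)) -
      f * (D n + f) * (D n - f)"
    by (rule dvd_diff)
  also have "\<dots> = f ^ 3 - (\<Sum>k\<le>n. of_nat (2 * k + 1) * s k)"
    by (simp add: algebra_simps power2_eq_square power3_eq_cube)
  finally have "fps_nth (f ^ 3) m = fps_nth (\<Sum>k\<le>n. of_nat (2 * k + 1) * s k) m"
    unfolding X_def fps_X_power_dvd_iff by simp
  also have "\<dots> = (\<Sum>k\<le>n. if triangular k = m then (-1) ^ k * (2 * int k + 1) else 0)"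
    unfolding fps_sum_nth
  proof (rule sum.cong)
    fix k
    have "of_nat (2 * k + 1) * s k =
        fps_const ((-1) ^ k * (2 * int k + 1)) * fps_X ^ triangular k"
      by (simp add: s_def fps_of_nat [symmetric] fps_const_power [symmetric]
            fps_const_mult [symmetric] fps_const_neg [symmetric] fps_const_add [symmetric]
            mult_ac del: fps_const_power fps_const_mult fps_const_neg fps_const_add)
    thus "fps_nth (of_nat (2 * k + 1) * s k) m =
        (if triangular k = m then (-1) ^ k * (2 * int k + 1) else 0)"
      by (simp only: fps_mult_left_const_nth fps_X_power_nth) simp
  qed simp
  also have "\<dots> = (\<Sum>k | k \<in> {..n} \<and> triangular k = m. (-1) ^ k * (2 * int k + 1))"
    by (rule sum.inter_filter [symmetric]) simp
  also have "{k. k \<in> {..n} \<and> triangular k = m} = {k. triangular k = m}"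
    using triangular_ge by (auto simp: n_def intro: trans_le_add1 simp: mult_2)
  finally show ?thesis
    by (simp add: f_def)
qed

section \<open>Sections of a power series along residue classes\<close>

definition fps_section :: "nat \<Rightarrow> nat \<Rightarrow> 'a fps \<Rightarrow> 'a fps" where
  "fps_section k r f = Abs_fps (\<lambda>n. fps_nth f (k * n + r))"

lemma fps_section_nth [simp]: "fps_nth (fps_section k r f) n = fps_nth f (k * n + r)"
  by (simp add: fps_section_def)

text \<open>
  If \<open>a + b\<close> is the only way to obtain the residue \<open>a + b\<close> as a sum of exponents of the two
  factors, then only the matching sections contribute to the Cauchy product.
\<close>
lemma fps_section_mult:
  fixes f g :: "'a::comm_ring_1 fps"
  assumes "a + b < k"
    and "\<And>i j. (i + j) mod k = a + b \<Longrightarrow> i mod k \<noteq> a \<Longrightarrow> fps_nth f i * fps_nth g j = 0"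
  shows "fps_section k (a + b) (f * g) = fps_section k a f * fps_section k b g"
proof (rule fps_ext)
  fix n
  define m where "m = k * n + (a + b)"
  have m: "m mod k = a + b"
    using assms(1) by (simp add: m_def)
  have "fps_nth (fps_section k (a + b) (f * g)) n = (\<Sum>i=0..m. fps_nth f i * fps_nth g (m - i))"
    by (simp add: fps_mult_nth m_def)
  also have "\<dots> = (\<Sum>i\<in>(\<lambda>j. k * j + a) ` {0..n}. fps_nth f i * fps_nth g (m - i))"
  proof (rule sum.mono_neutral_right)
    show "(\<lambda>j. k * j + a) ` {0..n} \<subseteq> {0..m}"
      by (auto simp: m_def intro!: trans_le_add1 mult_le_mono2)
    show "\<forall>i\<in>{0..m} - (\<lambda>j. k * j + a) ` {0..n}. fps_nth f i * fps_nth g (m - i) = 0"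
    proof
      fix i assume i: "i \<in> {0..m} - (\<lambda>j. k * j + a) ` {0..n}"
      have "i mod k \<noteq> a"
      proof
        assume "i mod k = a"
        hence eq: "i = k * (i div k) + a"
          by (metis mult_div_mod_eq)
        have "i div k \<le> m div k"
          using i by (intro div_le_mono) simp
        also have "m div k = n"
          using assms(1) by (simp add: m_def)
        finally show False
          using i eq by auto
      qed
      thus "fps_nth f i * fps_nth g (m - i) = 0"
        using i m by (intro assms(2)) auto
    qed
  qed simp
  also have "\<dots> = (\<Sum>j=0..n. fps_nth f (k * j + a) * fps_nth g (m - (k * j + a)))"
    using assms(1) by (subst sum.reindex) (auto simp: inj_on_def)
  also have "\<dots> = (\<Sum>j=0..n. fps_nth f (k * j + a) * fps_nth g (k * (n - j) + b))"
    by (intro sum.cong) (auto simp: m_def diff_mult_distrib2)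
  finally show "fps_nth (fps_section k (a + b) (f * g)) n =
      fps_nth (fps_section k a f * fps_section k b g) n"
    by (simp add: fps_mult_nth)
qed

lemma fps_nth_compose_X_power:
  fixes f :: "'a::comm_ring_1 fps"
  assumes "k > 0"
  shows "fps_nth (f oo fps_X ^ k) n = (if k dvd n then fps_nth f (n div k) else 0)"
proof -
  have "fps_nth (f oo fps_X ^ k) n = (\<Sum>i=0..n. if k * i = n then fps_nth f i else 0)"
    by (auto simp: fps_compose_nth power_mult [symmetric] intro!: sum.cong)
  also have "\<dots> = (\<Sum>i=0..n. if i = n div k \<and> k dvd n then fps_nth f i else 0)"
    using assms by (intro sum.cong) auto
  also have "\<dots> = (if k dvd n then fps_nth f (n div k) else 0)"
    by (cases "k dvd n") auto
  finally show ?thesis .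
qed

lemma fps_section_mult_compose:
  fixes f g :: "'a::comm_ring_1 fps"
  assumes "r < k"
  shows "fps_section k r (f * (g oo fps_X ^ k)) = fps_section k r f * g"
proof -
  have k: "k > 0" using assms by simp
  have "fps_section k (r + 0) (f * (g oo fps_X ^ k)) =
      fps_section k r f * fps_section k 0 (g oo fps_X ^ k)"
  proof (rule fps_section_mult)
    fix i j assume *: "(i + j) mod k = r + 0" "i mod k \<noteq> r"
    have "\<not> k dvd j"
      using * by auto
    thus "fps_nth f i * fps_nth (g oo fps_X ^ k) j = 0"
      using k by (simp add: fps_nth_compose_X_power)
  qed (use assms in simp)
  also have "fps_section k 0 (g oo fps_X ^ k) = g"
    using k by (intro fps_ext) (simp add: fps_nth_compose_X_power)
  finally show ?thesis by simp
qed

lemma euler_f_compose: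
  assumes "k > 0"
  shows "euler_f k = euler_f 1 oo fps_X ^ k"
proof (rule fps_ext)
  fix m
  have "(\<Prod>i<m. 1 - fps_X ^ (k * Suc i) :: int fps) =
      (\<Prod>i<m. 1 - fps_X ^ (1 * Suc i)) oo fps_X ^ k"
    using assms
    by (simp add: fps_compose_prod_distrib fps_compose_sub_distrib fps_X_power_compose
        flip: power_mult power_Suc)
  hence "fps_nth (euler_f k) m =
      fps_nth ((\<Prod>i<m. 1 - fps_X ^ (1 * Suc i)) oo fps_X ^ k) m"
    using euler_f_nth_eq_partial_product[OF assms order_refl, of m] by simp
  also have "\<dots> = fps_nth (euler_f 1 oo fps_X ^ k) m"
    using assms euler_f_nth_eq_partial_product[of 1 "m div k" m]
    by (simp add: fps_nth_compose_X_power)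
  finally show "fps_nth (euler_f k) m = fps_nth (euler_f 1 oo fps_X ^ k) m" .
qed

section \<open>The coefficients modulo powers of five\<close>

lemma mod_5_cases:
  fixes k :: int
  obtains l where "k = 5 * l" | l where "k = 5 * l + 1" | l where "k = 5 * l + 2"
    | l where "k = 5 * l + 3" | l where "k = 5 * l - 1"
proof -
  have "k = 5 * (k div 5) \<or> k = 5 * (k div 5) + 1 \<or> k = 5 * (k div 5) + 2 \<or>
      k = 5 * (k div 5) + 3 \<or> k = 5 * (k div 5 + 1) - 1"
    by presburger
  thus ?thesis using that by blast
qed

text \<open>
  Figurate numbers satisfy a polynomial formula without division only after doubling; this allows
  their residues to be read off the doubled formula, 2 being invertible modulo 5.
\<close>
lemma mod_5_from_double:
  fixes p r :: nat and c :: int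
  assumes "2 * int p = 5 * c + 2 * int r" "r < 5"
  shows "p mod 5 = r"
proof -
  have "5 * c = 2 * (int p - int r)"
    using assms(1) by simp
  hence "even (5 * c)"
    by simp
  then obtain d where "c = 2 * d"
    by (auto elim: evenE)
  hence "int p = 5 * d + int r"
    using assms(1) by simp
  hence "int (p mod 5) = int r"
    using assms(2) by (simp add: zmod_int)
  thus ?thesis
    by simp
qed

lemma pentagonal_mod_5:
  "pentagonal k mod 5 \<in> {0, 1, 2}"
  "pentagonal k mod 5 = 1 \<Longrightarrow> \<exists>l. k = - 5 * l - 1"
proof -
  have "pentagonal k mod 5 \<in> {0, 2} \<or> pentagonal k mod 5 = 1 \<and> (\<exists>l. k = - 5 * l - 1)"
  proof (cases k rule: mod_5_cases)
    case (1 l)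
    have "pentagonal k mod 5 = 0"
      by (rule mod_5_from_double[of _ "l * (15 * l + 1)"])
        (simp_all add: two_pentagonal 1 algebra_simps)
    thus ?thesis by simp
  next
    case (2 l)
    have "pentagonal k mod 5 = 2"
      by (rule mod_5_from_double[of _ "l * (15 * l + 7)"])
        (simp_all add: two_pentagonal 2 algebra_simps)
    thus ?thesis by simp
  next
    case (3 l)
    have "pentagonal k mod 5 = 2"
      by (rule mod_5_from_double[of _ "l * (15 * l + 13) + 2"])
        (simp_all add: two_pentagonal 3 algebra_simps)
    thus ?thesis by simp
  next
    case (4 l)
    have "pentagonal k mod 5 = 0"
      by (rule mod_5_from_double[of _ "l * (15 * l + 19) + 6"])
        (simp_all add: two_pentagonal 4 algebra_simps)
    thus ?thesis by simp
  next
    case (5 l)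
    have "pentagonal k mod 5 = 1"
      by (rule mod_5_from_double[of _ "l * (15 * l - 5)"])
        (simp_all add: two_pentagonal 5 algebra_simps)
    moreover have "k = - 5 * (- l) - 1" by (simp add: 5)
    ultimately show ?thesis by blast
  qed
  thus "pentagonal k mod 5 \<in> {0, 1, 2}"
    "pentagonal k mod 5 = 1 \<Longrightarrow> \<exists>l. k = - 5 * l - 1"
    by auto
qed

lemma pentagonal_5: "pentagonal (- 5 * l - 1) = 25 * pentagonal l + 1"
proof -
  have "2 * int (pentagonal (- 5 * l - 1)) = 2 * int (25 * pentagonal l + 1)"
    using two_pentagonal[of l] two_pentagonal[of "- 5 * l - 1"] by (simp add: algebra_simps)
  thus ?thesis by (simp only: mult_cancel_left of_nat_eq_iff) simp
qed

lemma triangular_mod_5: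
  "triangular k mod 5 \<in> {0, 1, 3}"
  "triangular k mod 5 = 3 \<Longrightarrow> \<exists>l. k = 5 * l + 2"
proof -
  have double: "2 * int (triangular k) = int k * (int k + 1)"
    using arg_cong[OF two_triangular[of k], of int] by (simp add: algebra_simps)
  have "triangular k mod 5 \<in> {0, 1} \<or> triangular k mod 5 = 3 \<and> (\<exists>l. k = 5 * l + 2)"
  proof (cases "int k" rule: mod_5_cases)
    case (1 l)
    have "triangular k mod 5 = 0"
      by (rule mod_5_from_double[of _ "l * (5 * l + 1)"], unfold double 1)
        (simp_all add: algebra_simps)
    thus ?thesis by simp
  next
    case (2 l)
    have "triangular k mod 5 = 1"
      by (rule mod_5_from_double[of _ "l * (5 * l + 3)"], unfold double 2)
        (simp_all add: algebra_simps)
    thus ?thesis by simp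
  next
    case (3 l)
    have "triangular k mod 5 = 3"
      by (rule mod_5_from_double[of _ "l * (5 * l + 5)"], unfold double 3)
        (simp_all add: algebra_simps)
    moreover have "k = 5 * nat l + 2" using 3 by linarith
    ultimately show ?thesis by blast
  next
    case (4 l)
    have "triangular k mod 5 = 1"
      by (rule mod_5_from_double[of _ "l * (5 * l + 7) + 2"], unfold double 4)
        (simp_all add: algebra_simps)
    thus ?thesis by simp
  next
    case (5 l)
    have "triangular k mod 5 = 0"
      by (rule mod_5_from_double[of _ "l * (5 * l - 1)"], unfold double 5)
        (simp_all add: algebra_simps)
    thus ?thesis by simp
  qed
  thus "triangular k mod 5 \<in> {0, 1, 3}" "triangular k mod 5 = 3 \<Longrightarrow> \<exists>l. k = 5 * l + 2"
    by auto
qed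

lemma triangular_5: "triangular (5 * l + 2) = 25 * triangular l + 3"
proof -
  have "2 * triangular (5 * l + 2) = 2 * (25 * triangular l + 3)"
    using two_triangular[of l] two_triangular[of "5 * l + 2"] by (simp add: algebra_simps)
  thus ?thesis by simp
qed

text \<open>
  The indices \<open>k = - 5 l - 1\<close> are exactly those whose pentagonal number is 1 modulo 5. It equals
  \<open>25 pentagonal l + 1\<close>, and the sign of \<open>k\<close> is opposite to that of \<open>l\<close>: Euler's series
  reproduces itself with \<open>q\<^sup>2\<^sup>5\<close> in place of \<open>q\<close>.
\<close>
lemma euler_f_section_1: "fps_section 5 1 (euler_f 1) = - euler_f 5"
proof (rule fps_ext)
  fix n
  have "{k. pentagonal k = 5 * n + 1} = (\<lambda>l. - 5 * l - 1) ` {l. 5 * pentagonal l = n}"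
  proof (intro equalityI subsetI)
    fix k assume k: "k \<in> {k. pentagonal k = 5 * n + 1}"
    hence "pentagonal k mod 5 = 1" by simp
    then obtain l where "k = - 5 * l - 1" using pentagonal_mod_5(2) by blast
    with k show "k \<in> (\<lambda>l. - 5 * l - 1) ` {l. 5 * pentagonal l = n}"
      using pentagonal_5[of l] by auto
  next
    fix k assume "k \<in> (\<lambda>l. - 5 * l - 1) ` {l. 5 * pentagonal l = n}"
    then obtain l where "k = - 5 * l - 1" "5 * pentagonal l = n" by blast
    thus "k \<in> {k. pentagonal k = 5 * n + 1}"
      using pentagonal_5[of l] by simp
  qed
  hence "fps_nth (euler_f 1) (5 * n + 1) =
      (\<Sum>k\<in>(\<lambda>l. - 5 * l - 1) ` {l. 5 * pentagonal l = n}. int_sign k)"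
    unfolding pentagonal_number_theorem by simp
  also have "\<dots> = (\<Sum>l | 5 * pentagonal l = n. int_sign (- 5 * l - 1))"
    by (subst sum.reindex) (auto simp: inj_on_def)
  also have "\<dots> = (\<Sum>l | 5 * pentagonal l = n. - int_sign l)"
    by (intro sum.cong) (auto simp: int_sign_def)
  also have "\<dots> = - fps_nth (euler_f 5) n"
  proof (cases "5 dvd n")
    case True
    hence "{l. 5 * pentagonal l = n} = {l. pentagonal l = n div 5}" by auto
    thus ?thesis using True
      by (simp add: euler_f_compose[of 5] fps_nth_compose_X_power sum_negf
          flip: One_nat_def) (simp add: pentagonal_number_theorem flip: One_nat_def)
  next
    case False
    hence empty: "{l. 5 * pentagonal l = n} = {}" by auto
    show ?thesis unfolding empty using False
      by (simp add: euler_f_compose[of 5] fps_nth_compose_X_power)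
  qed
  finally show "fps_nth (fps_section 5 1 (euler_f 1)) n = fps_nth (- euler_f 5) n"
    by simp
qed

lemma euler_f_5_power: "euler_f 5 ^ j = (euler_f 1 ^ j) oo fps_X ^ 5"
  unfolding euler_f_compose[of 5, simplified] by (simp add: fps_compose_power)

text \<open>
  The same self-similarity for Jacobi's series, with the indices \<open>k = 5 l + 2\<close>. Here the weight
  \<open>2 k + 1 = 5 (2 l + 1)\<close> is the source of the factor 5.
\<close>
lemma euler_f_cube_section_3: "fps_section 5 3 (euler_f 1 ^ 3) = 5 * euler_f 5 ^ 3"
proof (rule fps_ext)
  fix n
  define w where "w k = (-1) ^ k * (2 * int k + 1)" for k
  have "{k. triangular k = 5 * n + 3} = (\<lambda>l. 5 * l + 2) ` {l. 5 * triangular l = n}"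
  proof (intro equalityI subsetI)
    fix k assume k: "k \<in> {k. triangular k = 5 * n + 3}"
    hence "triangular k mod 5 = 3" by simp
    then obtain l where "k = 5 * l + 2" using triangular_mod_5(2) by blast
    with k show "k \<in> (\<lambda>l. 5 * l + 2) ` {l. 5 * triangular l = n}"
      using triangular_5[of l] by auto
  next
    fix k assume "k \<in> (\<lambda>l. 5 * l + 2) ` {l. 5 * triangular l = n}"
    then obtain l where "k = 5 * l + 2" "5 * triangular l = n" by blast
    thus "k \<in> {k. triangular k = 5 * n + 3}"
      using triangular_5[of l] by simp
  qed
  hence "fps_nth (euler_f 1 ^ 3) (5 * n + 3) =
      (\<Sum>k\<in>(\<lambda>l. 5 * l + 2) ` {l. 5 * triangular l = n}. w k)"
    unfolding jacobi_cube_identity w_def by simp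
  also have "\<dots> = (\<Sum>l | 5 * triangular l = n. w (5 * l + 2))"
    by (subst sum.reindex) (auto simp: inj_on_def)
  also have "\<dots> = (\<Sum>l | 5 * triangular l = n. 5 * w l)"
  proof (intro sum.cong refl)
    fix l
    have "(-1 :: int) ^ (5 * l + 2) = (-1) ^ l"
      by (simp add: minus_one_power_iff)
    thus "w (5 * l + 2) = 5 * w l"
      unfolding w_def by (simp only:) (simp add: algebra_simps)
  qed
  also have "\<dots> = 5 * fps_nth (euler_f 5 ^ 3) n"
  proof (cases "5 dvd n")
    case True
    hence "{l. 5 * triangular l = n} = {l. triangular l = n div 5}" by auto
    thus ?thesis using True unfolding euler_f_5_power
      by (simp add: fps_nth_compose_X_power jacobi_cube_identity w_def sum_distrib_left
          flip: One_nat_def)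
  next
    case False
    hence empty: "{l. 5 * triangular l = n} = {}" by auto
    show ?thesis unfolding empty euler_f_5_power using False
      by (simp add: fps_nth_compose_X_power)
  qed
  also have "\<dots> = fps_nth (5 * euler_f 5 ^ 3) n"
    by (simp add: fps_numeral_fps_const)
  finally show "fps_nth (fps_section 5 3 (euler_f 1 ^ 3)) n = fps_nth (5 * euler_f 5 ^ 3) n"
    by simp
qed

text \<open>
  Exponents of \<open>f\<close> lie in the residue classes 0, 1, 2 and those of \<open>f\<^sup>3\<close> in 0, 1, 3 modulo 5;
  the sum 1 + 3 is the only one congruent to 4.
\<close>
lemma euler_f_fourth_power_section_4:
  "fps_section 5 4 (euler_f 1 ^ 4) = - 5 * euler_f 5 ^ 4"
proof -
  have "fps_section 5 (1 + 3) (euler_f 1 * euler_f 1 ^ 3) =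
      fps_section 5 1 (euler_f 1) * fps_section 5 3 (euler_f 1 ^ 3)"
  proof (rule fps_section_mult)
    fix i j :: nat
    assume ij: "(i + j) mod 5 = 1 + 3" "i mod 5 \<noteq> 1"
    show "fps_nth (euler_f 1) i * fps_nth (euler_f 1 ^ 3) j = 0"
    proof (rule ccontr)
      assume *: "fps_nth (euler_f 1) i * fps_nth (euler_f 1 ^ 3) j \<noteq> 0"
      from * have "{k. pentagonal k = i} \<noteq> {}"
        unfolding pentagonal_number_theorem by (metis mult_zero_left sum.empty)
      hence i: "i mod 5 \<in> {0, 1, 2}" using pentagonal_mod_5(1) by force
      from * have "{k. triangular k = j} \<noteq> {}"
        unfolding jacobi_cube_identity by (metis mult_zero_right sum.empty)
      hence j: "j mod 5 \<in> {0, 1, 3}" using triangular_mod_5(1) by force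
      have "(i mod 5 + j mod 5) mod 5 = 4" using ij(1) by (simp add: mod_add_eq)
      thus False using i j ij(2) by auto
    qed
  qed simp
  thus ?thesis
    unfolding euler_f_section_1 euler_f_cube_section_3 by (simp add: eval_nat_numeral mult_ac)
qed

theorem P_star_5: "P_star (5 * n + 4) = - 5 * P_star n"
proof -
  have "fps_section 5 4 (euler_f 1 ^ 4 * euler_f 5 ^ 4) =
      fps_section 5 4 (euler_f 1 ^ 4) * euler_f 1 ^ 4"
    unfolding euler_f_5_power by (rule fps_section_mult_compose) simp
  also have "\<dots> = fps_const (- 5) * (euler_f 1 ^ 4 * euler_f 5 ^ 4)"
    unfolding euler_f_fourth_power_section_4
    by (simp add: fps_numeral_fps_const mult_ac flip: fps_const_neg)
  finally have "fps_nth (fps_section 5 4 (euler_f 1 ^ 4 * euler_f 5 ^ 4)) n =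
      - 5 * P_star n"
    by (simp only: fps_mult_left_const_nth P_star_def)
  thus ?thesis
    by (simp add: P_star_def)
qed

corollary P_star_power_5: "P_star (5 ^ \<alpha> * Suc n - 1) = (- 5) ^ \<alpha> * P_star n"
proof (induction \<alpha>)
  case (Suc \<alpha>)
  have "5 ^ \<alpha> * Suc n \<ge> 1" by (simp add: Suc_leI)
  moreover have "5 ^ Suc \<alpha> * Suc n = 5 * (5 ^ \<alpha> * Suc n)" by (simp only: power_Suc mult.assoc)
  ultimately have "5 ^ Suc \<alpha> * Suc n - 1 = 5 * (5 ^ \<alpha> * Suc n - 1) + 4" by linarith
  thus ?case
    by (simp only: P_star_5 Suc.IH power_Suc mult.assoc)
qed simp

section \<open>The coefficients modulo four\<close>

text \<open>
  The products for \<open>i\<close> and \<open>2 p + 1 - i\<close> coincide, and no index is its own partner.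
\<close>
lemma fps_square_nth_odd:
  fixes f :: "'a::comm_ring_1 fps"
  shows "fps_nth (f ^ 2) (2 * p + 1) = 2 * (\<Sum>i\<le>p. fps_nth f i * fps_nth f (2 * p + 1 - i))"
proof -
  define t where "t i = fps_nth f i * fps_nth f (2 * p + 1 - i)" for i
  have "fps_nth (f ^ 2) (2 * p + 1) = (\<Sum>i\<in>{..p} \<union> {p<..2 * p + 1}. t i)"
    unfolding power2_eq_square fps_mult_nth t_def by (intro sum.cong) auto
  also have "\<dots> = (\<Sum>i\<le>p. t i) + (\<Sum>i\<in>{p<..2 * p + 1}. t i)"
    by (intro sum.union_disjoint) auto
  also have "(\<Sum>i\<in>{p<..2 * p + 1}. t i) = (\<Sum>i\<le>p. t i)"
    by (rule sum.reindex_bij_witness[of _ "\<lambda>i. 2 * p + 1 - i" "\<lambda>i. 2 * p + 1 - i"])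
      (auto simp: t_def mult.commute)
  finally show ?thesis by (simp add: t_def)
qed

text \<open>
  One factor 2 comes from the pairing in the square of \<open>f\<^sup>2\<close>. The other one comes from the products
  themselves: one of two indices with an odd sum is odd, and the odd coefficients of \<open>f\<^sup>2\<close> are
  even.
\<close>
lemma four_dvd_fps_fourth_power_nth_odd:
  fixes f :: "int fps"
  assumes "odd m"
  shows "4 dvd fps_nth (f ^ 4) m"
proof -
  obtain p where m: "m = 2 * p + 1" using assms by (elim oddE)
  have even: "even (fps_nth (f ^ 2) i)" if "odd i" for i
    using that by (elim oddE) (simp only: fps_square_nth_odd, simp)
  have "f ^ 4 = (f ^ 2) ^ 2" by (simp flip: power_mult)
  hence "fps_nth (f ^ 4) m = 2 * (\<Sum>i\<le>p. fps_nth (f ^ 2) i * fps_nth (f ^ 2) (m - i))"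
    by (simp only: m fps_square_nth_odd)
  moreover have "2 dvd (\<Sum>i\<le>p. fps_nth (f ^ 2) i * fps_nth (f ^ 2) (m - i))"
  proof (rule dvd_sum)
    fix i assume "i \<in> {..p}"
    hence "odd i \<or> odd (m - i)" using m by auto
    thus "2 dvd fps_nth (f ^ 2) i * fps_nth (f ^ 2) (m - i)"
      using even by (metis dvd_mult dvd_mult2)
  qed
  ultimately show ?thesis by auto
qed

theorem theorem5:
  fixes n \<alpha> :: nat
  assumes "\<alpha> \<ge> 1"
  shows "[P_star (2 * 5 ^ \<alpha> * n + 2 * 5 ^ \<alpha> - 1) = 0] (mod (2 ^ 2 * 5 ^ \<alpha>))"
proof -
  have "P_star (2 * n + 1) = fps_nth ((euler_f 1 * euler_f 5) ^ 4) (2 * n + 1)"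
    by (simp add: P_star_def power_mult_distrib)
  hence "4 dvd P_star (2 * n + 1)"
    using four_dvd_fps_fourth_power_nth_odd[of "2 * n + 1"] by simp
  hence "4 * 5 ^ \<alpha> dvd P_star (2 * n + 1) * (- 5) ^ \<alpha>"
    by (intro mult_dvd_mono) (auto simp: power_minus[of 5])
  also have "P_star (2 * n + 1) * (- 5) ^ \<alpha> = P_star (5 ^ \<alpha> * Suc (2 * n + 1) - 1)"
    by (simp only: P_star_power_5 mult.commute)
  also have "5 ^ \<alpha> * Suc (2 * n + 1) = 2 * 5 ^ \<alpha> * n + 2 * 5 ^ \<alpha>"
    by (simp add: algebra_simps)
  finally show ?thesis
    by (simp add: cong_0_iff)
qed

end
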